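(* If a $P$-space $X$ has an $\omega$-thin labeling (or an $\omega_1$-thin labeling), then $X$ has the smallest dimensional type in the class of all crowded $P$-spaces of weight $\omega_1$; that is, $X$ belongs to this class, and $X$ is homeomorphic to a subspace of every crowded $P$-space of weight $\omega_1$.
   Context: A $P$-space is a completely regular $T_1$-space in which every countable intersection of open sets is open. A space is crowded if it has no isolated points (it is dense in itself). The dimensional type of $X$ is less than or equal to that of $Y$ if $X$ is homeomorphic to a subspace of $Y$. A partition of a space is a cover by pairwise disjoint nonempty open (hence clopen) sets. A $P$-matrix for a $P$-space $X$ is a family $\mathfrak{M}_X=\{\mathcal{P}_\alpha:\alpha<\omega_1\}$ such that: (1) each $\mathcal{P}_\alpha$ is a partition of $X$; (2) if $\beta<\alpha$, then $\mathcal{P}_\alpha$ refines $\mathcal{P}_\beta$; (3) $\bigcup\mathfrak{M}_X=\bigcup_{\alpha<\omega_1}\mathcal{P}_\alpha$ is a base for $X$; (4) if $\alpha$ is an infinite limit ordinal and $U\in\mathcal{P}_\alpha$, then $U=\bigcap\{V\in\mathcal{P}_\beta:\beta<\alpha,\ U\subseteq V\}$. A labeling is a surjection $E\colon\bigcup\mathfrak{M}_X\to X$ such that $E(V)\in V$ for all $V\in\bigcup\mathfrak{M}_X$, and whenever $U,V\in\bigcup\mathfrak{M}_X$, $U\subseteq V$ and $E(V)\in U$, then $E(U)=E(V)$. For an infinite cardinal $\lambda$, the space $X$ has a $\lambda$-thin labeling if there exist a $P$-matrix $\{\mathcal{P}_\alpha:\alpha<\omega_1\}$ for $X$ and a labeling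 $E$ on it such that: each $\mathcal{P}_\alpha$ has cardinality $\lambda$, and for $\beta<\alpha$ every $V\in\mathcal{P}_\beta$ contains $\lambda$ many elements of $\mathcal{P}_\alpha$; and, for every $\alpha<\omega_1$ and every nonempty chain (with respect to inclusion) $\mathcal{L}\subseteq\bigcup\{\mathcal{P}_\beta:\beta<\alpha\}$ with $\bigcap\mathcal{L}\neq\emptyset$, there is $V\in\mathcal{L}$ with $E(V)\in\bigcap\mathcal{L}$. *)

theory Defs
  imports "HOL-Analysis.Analysis"
begin

unbundle cardinal_syntax

text \<open>The library represents ordinals and cardinals by well-order relations. Thus \<open>\<omega>\<close> is
  \<^const>\<open>natLeq\<close>, and the first uncountable cardinal is its cardinal successor: the ordinals
  \<open>\<alpha> < \<omega>\<^sub>1\<close> are the elements of its field, and \<open>\<beta> < \<alpha>\<close> is \<open>\<beta> \<in> underS omega1 \<alpha>\<close>.\<close>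

abbreviation omega1 :: "nat set rel" where
  "omega1 \<equiv> cardSuc natLeq"

definition P_space :: "'a topology \<Rightarrow> bool" where
  "P_space X \<longleftrightarrow> completely_regular_space X \<and> t1_space X \<and>
     (\<forall>\<U>. countable \<U> \<and> \<U> \<noteq> {} \<and> (\<forall>U\<in>\<U>. openin X U) \<longrightarrow> openin X (\<Inter>\<U>))"

definition crowded :: "'a topology \<Rightarrow> bool" where
  "crowded X \<longleftrightarrow> (\<forall>x\<in>topspace X. \<not> openin X {x})"

definition is_base :: "'a topology \<Rightarrow> 'a set set \<Rightarrow> bool" where
  "is_base X \<B> \<longleftrightarrow> (\<forall>B\<in>\<B>. openin X B) \<and>
     (\<forall>U x. openin X U \<and> x \<in> U \<longrightarrow> (\<exists>B\<in>\<B>. x \<in> B \<and> B \<subseteq> U))"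

text \<open>The weight of \<open>X\<close>, the least cardinality of a base, equals \<open>\<kappa>\<close>.\<close>

definition has_weight :: "'a topology \<Rightarrow> 'k rel \<Rightarrow> bool" where
  "has_weight X \<kappa> \<longleftrightarrow> (\<exists>\<B>. is_base X \<B> \<and> |\<B>| =o \<kappa>) \<and> (\<forall>\<B>. is_base X \<B> \<longrightarrow> \<kappa> \<le>o |\<B>| )"

definition dim_type_le :: "'a topology \<Rightarrow> 'b topology \<Rightarrow> bool" where
  "dim_type_le X Y \<longleftrightarrow> (\<exists>S\<subseteq>topspace Y. X homeomorphic_space subtopology Y S)"

definition open_partition :: "'a topology \<Rightarrow> 'a set set \<Rightarrow> bool" where
  "open_partition X \<P> \<longleftrightarrow> partition_on (topspace X) \<P> \<and> (\<forall>U\<in>\<P>. openin X U)"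

definition limit_ordinal :: "'k rel \<Rightarrow> 'k \<Rightarrow> bool" where
  "limit_ordinal r \<alpha> \<longleftrightarrow> \<alpha> \<in> Field r \<and> underS r \<alpha> \<noteq> {} \<and>
     (\<forall>\<beta>\<in>underS r \<alpha>. \<exists>\<gamma>\<in>underS r \<alpha>. \<beta> \<in> underS r \<gamma>)"

text \<open>The union of all members of the family; values of \<open>P\<close> off the field of
  \<^term>\<open>omega1\<close> are irrelevant.\<close>

definition cells :: "(nat set \<Rightarrow> 'a set set) \<Rightarrow> 'a set set" where
  "cells P = (\<Union>\<alpha>\<in>Field omega1. P \<alpha>)"

definition P_matrix :: "'a topology \<Rightarrow> (nat set \<Rightarrow> 'a set set) \<Rightarrow> bool" where
  "P_matrix X P \<longleftrightarrow>
     (\<forall>\<alpha>\<in>Field omega1. open_partition X (P \<alpha>)) \<and>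
     (\<forall>\<alpha>\<in>Field omega1. \<forall>\<beta>\<in>underS omega1 \<alpha>. \<forall>U\<in>P \<alpha>. \<exists>V\<in>P \<beta>. U \<subseteq> V) \<and>
     is_base X (cells P) \<and>
     (\<forall>\<alpha>. limit_ordinal omega1 \<alpha> \<longrightarrow>
        (\<forall>U\<in>P \<alpha>. U = \<Inter>{V. \<exists>\<beta>\<in>underS omega1 \<alpha>. V \<in> P \<beta> \<and> U \<subseteq> V}))"

definition labeling :: "'a topology \<Rightarrow> (nat set \<Rightarrow> 'a set set) \<Rightarrow> ('a set \<Rightarrow> 'a) \<Rightarrow> bool" where
  "labeling X P E \<longleftrightarrow>
     E ` cells P = topspace X \<and>
     (\<forall>V\<in>cells P. E V \<in> V) \<and>
     (\<forall>U\<in>cells P. \<forall>V\<in>cells P. U \<subseteq> V \<and> E V \<in> U \<longrightarrow> E U = E V)"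

definition has_thin_labeling :: "'k rel \<Rightarrow> 'a topology \<Rightarrow> bool" where
  "has_thin_labeling \<kappa> X \<longleftrightarrow> Cinfinite \<kappa> \<and>
     (\<exists>P E. P_matrix X P \<and> labeling X P E \<and>
        (\<forall>\<alpha>\<in>Field omega1. |P \<alpha>| =o \<kappa>) \<and>
        (\<forall>\<alpha>\<in>Field omega1. \<forall>\<beta>\<in>underS omega1 \<alpha>. \<forall>V\<in>P \<beta>. |{U \<in> P \<alpha>. U \<subseteq> V}| =o \<kappa>) \<and>
        (\<forall>\<alpha>\<in>Field omega1. \<forall>\<L>.
           \<L> \<noteq> {} \<and> \<L> \<subseteq> (\<Union>\<beta>\<in>underS omega1 \<alpha>. P \<beta>) \<and> chain\<^sub>\<subseteq> \<L> \<and> \<Inter>\<L> \<noteq> {} \<longrightarrow>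
           (\<exists>V\<in>\<L>. E V \<in> \<Inter>\<L>)))"

definition crowded_P_space_of_weight_omega1 :: "'a topology \<Rightarrow> bool" where
  "crowded_P_space_of_weight_omega1 X \<longleftrightarrow> P_space X \<and> crowded X \<and> has_weight X omega1"

end

theory Submission
  imports Defs "HOL-Library.Countable_Set_Type"
begin

text \<open>Let \<open>Y\<close> be a crowded \<open>P\<close>-space with base \<open>{B\<^sub>\<alpha> : \<alpha> < \<omega>\<^sub>1}\<close>. By transfinite recursion on \<open>\<alpha>\<close>, every
  cell \<open>U \<in> P\<^sub>\<alpha>\<close> receives an open set \<open>W\<^sub>U\<close> of \<open>Y\<close> and a point \<open>p\<^sub>U \<in> W\<^sub>U\<close> such that the sets of one level
  are disjoint, \<open>W\<close> respects inclusion of cells, \<open>p\<^sub>U = p\<^sub>V\<close> when \<open>U \<subseteq> V\<close> and \<open>E V \<in> U\<close>, and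
  \<open>W\<^sub>U \<subseteq> B\<^sub>\<beta>\<close> for all \<open>\<beta> < \<alpha>\<close> with \<open>p\<^sub>U \<in> B\<^sub>\<beta>\<close>. At stage \<open>\<alpha>\<close> the cells with the same larger cells
  share the countable intersection of the sets already assigned; it is open, and nonempty because the
  thinness condition puts the image of some label into it. Being crowded, it contains uncountably
  many disjoint open sets, enough for the at most \<open>\<omega>\<^sub>1\<close> cells of level \<open>\<alpha>\<close>. Then
  \<open>f (E U) = p\<^sub>U\<close> is well defined, \<open>f x \<in> W\<^sub>U\<close> iff \<open>x \<in> U\<close>, and \<open>f\<close> is an embedding.\<close>

section \<open>The order of the countable ordinals\<close>

lemma Card_order_omega1: "Card_order omega1"
  by (simp add: cardSuc_Card_order natLeq_Card_order)

lemma wo_rel_omega1: "wo_rel omega1"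
  using Card_order_omega1 by (simp add: card_order_on_def wo_rel_def)

text \<open>A cardinal is at least the successor of \<open>natLeq\<close> exactly when it exceeds
  \<open>natLeq\<close>. Size estimates thereby reduce to countability.\<close>

lemma omega1_ordLeq_iff_uncountable: "omega1 \<le>o |A| \<longleftrightarrow> uncountable A"
proof -
  have "omega1 \<le>o |A| \<longleftrightarrow> natLeq <o |A|"
    by (metis cardSuc_least cardSuc_greater card_of_Card_order natLeq_Card_order ordLess_ordLeq_trans)
  also have "\<dots> \<longleftrightarrow> uncountable A"
    by (metis countable_card_le_natLeq not_ordLess_iff_ordLeq card_of_Well_order natLeq_Well_order)
  finally show ?thesis .
qed

text \<open>Initial segments of a cardinal are strictly smaller than it. Hence in a P-space all sets
  chosen at earlier stages may be intersected.\<close>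

lemma countable_underS_omega1: "\<alpha> \<in> Field omega1 \<Longrightarrow> countable (underS omega1 \<alpha>)"
  by (metis Card_order_omega1 card_of_underS card_of_Card_order natLeq_Card_order
      cardSuc_ordLeq_ordLess countable_card_le_natLeq)

lemma infinite_omega1: "infinite (Field omega1)"
  using cardSuc_finite[OF natLeq_Card_order] by (simp only: Field_natLeq infinite_UNIV_nat simp_thms)

lemma omega1_no_max:
  assumes "\<alpha> \<in> Field omega1" shows "\<exists>\<gamma>\<in>Field omega1. \<alpha> \<in> underS omega1 \<gamma>"
proof -
  have "\<not> finite (Field omega1)"
    using infinite_omega1 by blast
  then show ?thesis
    using infinite_Card_order_limit[OF Card_order_omega1 _ assms]
    by (auto simp: underS_def)
qed

lemma omega1_cases:
  assumes "\<alpha> \<in> Field omega1" "\<beta> \<in> Field omega1"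
  obtains "\<alpha> = \<beta>" | "\<alpha> \<in> underS omega1 \<beta>" | "\<beta> \<in> underS omega1 \<alpha>"
  using wo_rel.TOTALS[OF wo_rel_omega1] assms by (auto simp: underS_def)

lemma underS_omega1_trans:
  "\<alpha> \<in> underS omega1 \<beta> \<Longrightarrow> \<beta> \<in> underS omega1 \<gamma> \<Longrightarrow> \<alpha> \<in> underS omega1 \<gamma>"
  using wo_rel.TRANS[OF wo_rel_omega1] wo_rel.ANTISYM[OF wo_rel_omega1]
  by (metis underS_E underS_I antisym_def transD)

lemma underS_omega1_Field: "\<alpha> \<in> underS omega1 \<beta> \<Longrightarrow> \<alpha> \<in> Field omega1"
  by (metis underS_E FieldI1)

text \<open>Used for continuity: it gives a level beyond both the index of a basic set and the level
  of a labelled cell.\<close>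

lemma omega1_upper_bound:
  assumes "\<alpha> \<in> Field omega1" "\<beta> \<in> Field omega1"
  shows "\<exists>\<gamma>\<in>Field omega1. \<alpha> \<in> underS omega1 \<gamma> \<and> \<beta> \<in> underS omega1 \<gamma>"
  using assms(1,2)
proof (cases rule: omega1_cases)
  case 1
  then show ?thesis using omega1_no_max[OF assms(2)] by simp
next
  case 2
  then show ?thesis using omega1_no_max[OF assms(2)] underS_omega1_trans by blast
next
  case 3
  then show ?thesis using omega1_no_max[OF assms(1)] underS_omega1_trans by blast
qed

lemma wf_omega1: "wf {(\<beta>, \<alpha>). \<beta> \<in> underS omega1 \<alpha>}"
proof -
  have "{(\<beta>, \<alpha>). \<beta> \<in> underS omega1 \<alpha>} = omega1 - Id"
    by (auto simp: underS_def)
  then show ?thesis using wo_rel.WF[OF wo_rel_omega1] by simp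
qed

section \<open>Disjoint open sets in crowded P-spaces\<close>

lemma P_space_Hausdorff: "P_space Y \<Longrightarrow> Hausdorff_space Y"
  by (simp add: P_space_def completely_regular_imp_regular_space regular_t1_imp_Hausdorff_space)

text \<open>The factor \<open>M\<close> keeps the intersection open for \<open>I = {}\<close>, where
  the bare intersection would be \<open>UNIV\<close>.\<close>

lemma P_space_openin_INT:
  assumes "P_space Y" "openin Y M" "countable I" "\<And>i. i \<in> I \<Longrightarrow> openin Y (F i)"
  shows "openin Y (M \<inter> (\<Inter>i\<in>I. F i))"
proof -
  have "countable (insert M (F ` I))" "\<forall>U\<in>insert M (F ` I). openin Y U" using assms by auto
  then have "openin Y (\<Inter>(insert M (F ` I)))"
    using assms(1) unfolding P_space_def by (meson insert_not_empty)
  then show ?thesis by simp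
qed

text \<open>Since \<open>{q}\<close> is not open, \<open>M\<close> has a second point
  \<open>w\<close>; Hausdorff neighbourhoods of the two are cut down to \<open>M\<close>.\<close>

lemma crowded_split:
  assumes "Hausdorff_space Y" "crowded Y" "openin Y M" "q \<in> M"
  obtains A B w where "openin Y A" "openin Y B" "q \<in> A" "w \<in> B" "A \<subseteq> M" "B \<subseteq> M" "A \<inter> B = {}"
proof -
  have qY: "q \<in> topspace Y" using assms openin_subset by blast
  with assms have "M \<noteq> {q}" by (auto simp: crowded_def)
  then obtain w where w: "w \<in> M" "w \<noteq> q" using assms by blast
  then have "w \<in> topspace Y" using assms openin_subset by blast
  then obtain A B where "openin Y A" "openin Y B" "q \<in> A" "w \<in> B" "disjnt A B"
    using assms(1) w qY unfolding Hausdorff_space_def by metis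
  then show thesis using that[of "A \<inter> M" "B \<inter> M" w] assms w
    by (auto simp: disjnt_def)
qed

text \<open>By Zorn there is a maximal disjoint family of nonempty open subsets of \<open>M\<close>,
  each missed by a neighbourhood of \<open>z\<close>. If it were countable, these neighbourhoods
  would intersect in an open set around \<open>z\<close>, which splits and yields a further
  member.\<close>

lemma uncountable_disjoint_open_family:
  assumes Y: "P_space Y" "crowded Y" and M: "openin Y M" "z \<in> M"
  obtains \<F> where "uncountable \<F>" "disjoint \<F>" "\<And>F. F \<in> \<F> \<Longrightarrow> openin Y F \<and> F \<noteq> {} \<and> F \<subseteq> M"
proof -
  define good where "good = {\<F>. disjoint \<F> \<and> (\<forall>F\<in>\<F>. openin Y F \<and> F \<noteq> {} \<and> F \<subseteq> M \<and>
    (\<exists>N. openin Y N \<and> z \<in> N \<and> N \<inter> F = {}))}"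
  have "\<Union>\<C> \<in> good" if "subset.chain good \<C>" for \<C>
  proof -
    have C: "\<C> \<subseteq> good"
      using that by (auto simp: subset_chain_def)
    have "disjoint (\<Union>\<C>)"
      using that C by (intro pairwise_chain_Union) (auto simp: good_def subset_chain_def chain_subset_def)
    then show ?thesis using C unfolding good_def by blast
  qed
  then obtain \<F> where F: "\<F> \<in> good" and max: "\<And>\<G>. \<G> \<in> good \<Longrightarrow> \<F> \<subseteq> \<G> \<Longrightarrow> \<G> = \<F>"
    using subset_Zorn'[of good] by metis
  have "uncountable \<F>"
  proof
    assume cF: "countable \<F>"
    from F obtain N where N: "\<And>F. F \<in> \<F> \<Longrightarrow> openin Y (N F) \<and> z \<in> N F \<and> N F \<inter> F = {}"
      unfolding good_def by (simp add: Ball_def) metis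
    have "openin Y (M \<inter> (\<Inter>F\<in>\<F>. N F))"
      by (rule P_space_openin_INT[OF Y(1) M(1) cF]) (use N in blast)
    moreover have "z \<in> M \<inter> (\<Inter>F\<in>\<F>. N F)" using M N by blast
    ultimately obtain A B w where AB: "openin Y A" "openin Y B" "z \<in> A" "w \<in> B"
        "B \<subseteq> M \<inter> (\<Inter>F\<in>\<F>. N F)" "A \<inter> B = {}"
      using crowded_split[OF P_space_Hausdorff[OF Y(1)] Y(2)] by metis
    then have disj: "\<And>F. F \<in> \<F> \<Longrightarrow> B \<inter> F = {}" using N by blast
    \<comment> \<open>\<open>A\<close> is the neighbourhood of \<open>z\<close> that misses
      \<open>B\<close>.\<close>
    have "insert B \<F> \<in> good"
      using F AB disj unfolding good_def by (auto simp: pairwise_insert disjnt_def)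
    then have "B \<in> \<F>" using max by blast
    then show False using disj AB by blast
  qed
  then show thesis using that[of \<F>] F unfolding good_def by blast
qed

text \<open>\<open>M\<close> is split: the part around \<open>q\<close> is reserved for
  \<open>u0\<close>, and the other part holds an uncountable disjoint family into which
  \<open>S\<close> is injected.\<close>

lemma disjoint_open_system:
  fixes u0 :: 'i
  assumes Y: "P_space Y" "crowded Y" and M: "openin Y M" "q \<in> M" and S: "|S| \<le>o omega1"
  obtains w where "\<And>u. u \<in> S \<Longrightarrow> openin Y (w u) \<and> w u \<noteq> {} \<and> w u \<subseteq> M"
    "disjoint_family_on w S" "q \<in> w u0"
proof -
  obtain A B z where AB: "openin Y A" "openin Y B" "q \<in> A" "z \<in> B" "A \<subseteq> M" "B \<subseteq> M" "A \<inter> B = {}"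
    using crowded_split[OF P_space_Hausdorff[OF Y(1)] Y(2) M] by metis
  obtain \<F> where F: "uncountable \<F>" "disjoint \<F>" "\<And>F. F \<in> \<F> \<Longrightarrow> openin Y F \<and> F \<noteq> {} \<and> F \<subseteq> B"
    using uncountable_disjoint_open_family[OF Y AB(2,4)] by metis
  \<comment> \<open>An uncountable family has at least \<open>omega1\<close> members.\<close>
  have "|S| \<le>o |\<F>|" using S F(1) by (meson omega1_ordLeq_iff_uncountable ordLeq_transitive)
  then obtain g where g: "inj_on g S" "g ` S \<subseteq> \<F>" by (auto simp: card_of_ordLeq[symmetric])
  show thesis
  proof (rule that[of "g(u0 := A)"])
    show "openin Y ((g(u0 := A)) u) \<and> (g(u0 := A)) u \<noteq> {} \<and> (g(u0 := A)) u \<subseteq> M" if "u \<in> S" for u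
      using that g(2) F(3)[of "g u"] AB by auto
    have "g u \<inter> g v = {}" if "u \<in> S" "v \<in> S" "u \<noteq> v" for u v
      using that g F(2) by (metis (no_types) disjnt_def image_subset_iff inj_on_def pairwiseD)
    moreover have "g u \<inter> A = {}" if "u \<in> S" for u
      using that g(2) F(3)[of "g u"] AB by blast
    ultimately show "disjoint_family_on (g(u0 := A)) S"
      unfolding disjoint_family_on_def by (auto simp: Int_commute)
  qed (use AB in auto)
qed

section \<open>Cells and labels of a P-matrix\<close>

lemma P_matrix_base: "P_matrix X P \<Longrightarrow> is_base X (cells P)"
  unfolding P_matrix_def by (elim conjE)

lemma P_matrix_open_partition:
  assumes "P_matrix X P" "\<alpha> \<in> Field omega1"
  shows "open_partition X (P \<alpha>)"
  by (rule bspec[OF conjunct1[OF assms(1)[unfolded P_matrix_def]] assms(2)])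

lemma P_matrix_refines:
  assumes "P_matrix X P" "\<alpha> \<in> Field omega1" "\<beta> \<in> underS omega1 \<alpha>" "U \<in> P \<alpha>"
  shows "\<exists>V\<in>P \<beta>. U \<subseteq> V"
  by (rule bspec[OF bspec[OF bspec[OF conjunct1[OF conjunct2[OF assms(1)[unfolded P_matrix_def]]] assms(2)] assms(3)] assms(4)])

text \<open>The size of a level is bounded by \<open>omega1\<close> rather than fixed, so one
  construction covers both cases of the theorem.\<close>

locale thin_matrix =
  fixes X :: "'a topology" and P :: "nat set \<Rightarrow> 'a set set" and E :: "'a set \<Rightarrow> 'a"
  assumes T1: "t1_space X"
    and matrix: "P_matrix X P"
    and labels: "labeling X P E"
    and card_le: "\<alpha> \<in> Field omega1 \<Longrightarrow> |P \<alpha>| \<le>o omega1"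
    and thin: "\<alpha> \<in> Field omega1 \<Longrightarrow> \<L> \<noteq> {} \<Longrightarrow> \<L> \<subseteq> (\<Union>\<beta>\<in>underS omega1 \<alpha>. P \<beta>) \<Longrightarrow>
      chain\<^sub>\<subseteq> \<L> \<Longrightarrow> \<Inter>\<L> \<noteq> {} \<Longrightarrow> \<exists>V\<in>\<L>. E V \<in> \<Inter>\<L>"
begin

lemma open_partition_level: "\<alpha> \<in> Field omega1 \<Longrightarrow> open_partition X (P \<alpha>)"
  by (rule P_matrix_open_partition[OF matrix])

lemma level_disjoint:
  "\<alpha> \<in> Field omega1 \<Longrightarrow> U \<in> P \<alpha> \<Longrightarrow> V \<in> P \<alpha> \<Longrightarrow> x \<in> U \<Longrightarrow> x \<in> V \<Longrightarrow> U = V"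
  using open_partition_level[of \<alpha>]
  by (auto simp: open_partition_def partition_on_def pairwise_def disjnt_def)

lemma level_cover: "\<alpha> \<in> Field omega1 \<Longrightarrow> x \<in> topspace X \<Longrightarrow> \<exists>U\<in>P \<alpha>. x \<in> U"
  using open_partition_level[of \<alpha>] by (auto simp: open_partition_def partition_on_def)

lemma level_subset: "\<alpha> \<in> Field omega1 \<Longrightarrow> U \<in> P \<alpha> \<Longrightarrow> U \<subseteq> topspace X"
  using open_partition_level[of \<alpha>] by (auto simp: open_partition_def partition_on_def)

lemma level_nonempty: "\<alpha> \<in> Field omega1 \<Longrightarrow> U \<in> P \<alpha> \<Longrightarrow> U \<noteq> {}"
  using open_partition_level[of \<alpha>] by (auto simp: open_partition_def partition_on_def)

lemma refines_level:
  "\<alpha> \<in> Field omega1 \<Longrightarrow> \<beta> \<in> underS omega1 \<alpha> \<Longrightarrow> U \<in> P \<alpha> \<Longrightarrow> \<exists>V\<in>P \<beta>. U \<subseteq> V"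
  by (rule P_matrix_refines[OF matrix])

text \<open>Refinement puts \<open>U\<close> into some cell of level \<open>\<beta>\<close>; it
  shares \<open>x\<close> with \<open>V\<close> and so equals \<open>V\<close>.\<close>

lemma nested_cells:
  assumes "\<alpha> \<in> Field omega1" "\<beta> \<in> underS omega1 \<alpha>" "U \<in> P \<alpha>" "V \<in> P \<beta>" "x \<in> U" "x \<in> V"
  shows "U \<subseteq> V"
proof -
  obtain V' where "V' \<in> P \<beta>" "U \<subseteq> V'" using refines_level[OF assms(1-3)] by blast
  then show ?thesis
    using level_disjoint[OF underS_omega1_Field[OF assms(2)]] assms by blast
qed

lemma label_in: "\<alpha> \<in> Field omega1 \<Longrightarrow> V \<in> P \<alpha> \<Longrightarrow> E V \<in> V"
  using labels unfolding labeling_def cells_def by blast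

lemma label_inherit:
  assumes "\<alpha> \<in> Field omega1" "\<beta> \<in> Field omega1" "U \<in> P \<alpha>" "V \<in> P \<beta>" "U \<subseteq> V" "E V \<in> U"
  shows "E U = E V"
proof -
  have "U \<in> cells P" "V \<in> cells P" using assms by (auto simp: cells_def)
  then show ?thesis using labels assms(5,6) unfolding labeling_def by blast
qed

lemma label_surj:
  assumes "x \<in> topspace X"
  obtains \<beta> V where "\<beta> \<in> Field omega1" "V \<in> P \<beta>" "E V = x"
proof -
  have "E ` cells P = topspace X" by (rule conjunct1[OF labels[unfolded labeling_def]])
  then have "x \<in> E ` cells P" using assms by simp
  then obtain V where V: "V \<in> cells P" "x = E V" by (rule imageE)
  obtain \<beta> where "\<beta> \<in> Field omega1" "V \<in> P \<beta>"
    using V(1) unfolding cells_def by (rule UN_E)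
  then show thesis using that V(2)[symmetric] by simp
qed

text \<open>Cells of level \<open>\<alpha>\<close> with equal \<open>above\<close> have the same
  history: they are subject to the same earlier open sets.\<close>

definition above :: "nat set \<Rightarrow> 'a set \<Rightarrow> 'a set set" where
  "above \<alpha> U = {V. \<exists>\<beta>\<in>underS omega1 \<alpha>. V \<in> P \<beta> \<and> U \<subseteq> V}"

text \<open>The members all contain the nonempty \<open>U\<close>, and cells sharing a point are
  nested. This makes thinness applicable to \<open>above \<alpha> U\<close>.\<close>

lemma chain_above:
  assumes "\<alpha> \<in> Field omega1" "U \<in> P \<alpha>"
  shows "chain\<^sub>\<subseteq> (above \<alpha> U)"
  unfolding chain_subset_def
proof (intro ballI)
  fix V W assume "V \<in> above \<alpha> U" "W \<in> above \<alpha> U"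
  then obtain \<beta> \<gamma> where *: "\<beta> \<in> Field omega1" "V \<in> P \<beta>" "U \<subseteq> V" "\<gamma> \<in> Field omega1" "W \<in> P \<gamma>" "U \<subseteq> W"
    unfolding above_def using underS_omega1_Field by blast
  obtain x where "x \<in> U" using level_nonempty[OF assms] by blast
  with * have x: "x \<in> V" "x \<in> W" by auto
  show "V \<subseteq> W \<or> W \<subseteq> V"
    using *(1,4)
  proof (cases rule: omega1_cases)
    case 1 then show ?thesis using level_disjoint * x by blast
  next
    case 2 then show ?thesis using nested_cells[of \<gamma> \<beta>] * x by blast
  next
    case 3 then show ?thesis using nested_cells[of \<beta> \<gamma>] * x by blast
  qed
qed

end

section \<open>The transfinite construction of open sets and points\<close>

text \<open>The base is enumerated along \<open>omega1\<close> so that only countably many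
  \<open>B \<beta>\<close> precede a stage. \<open>nonempty_Y\<close> supplies a point at the first
  level.\<close>

locale thin_matrix_target = thin_matrix X P E
  for X :: "'a topology" and P E +
  fixes Y :: "'b topology" and B :: "nat set \<Rightarrow> 'b set"
  assumes P_space_Y: "P_space Y"
    and crowded_Y: "crowded Y"
    and base_Y: "is_base Y (B ` Field omega1)"
    and nonempty_Y: "topspace Y \<noteq> {}"
begin

lemma openin_B: "\<alpha> \<in> Field omega1 \<Longrightarrow> openin Y (B \<alpha>)"
  using base_Y by (auto simp: is_base_def)

text \<open>A stage \<open>d\<close> at level \<open>\<alpha>\<close> sends each cell \<open>U\<close> to an open set of \<open>Y\<close> that will contain the image
  of \<open>U\<close>, and to a point of this set that will be the image of \<open>E U\<close>.\<close>

definition stage_on ::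
  "'a set set \<Rightarrow> (nat set \<Rightarrow> 'a set \<Rightarrow> 'b set \<times> 'b) \<Rightarrow> nat set \<Rightarrow> ('a set \<Rightarrow> 'b set \<times> 'b) \<Rightarrow> bool" where
  "stage_on S h \<alpha> d \<longleftrightarrow>
    (\<forall>U\<in>S. openin Y (fst (d U)) \<and> snd (d U) \<in> fst (d U)) \<and>
    (\<forall>U\<in>S. \<forall>U'\<in>S. U \<noteq> U' \<longrightarrow> fst (d U) \<inter> fst (d U') = {}) \<and>
    (\<forall>U\<in>S. \<forall>\<beta>\<in>underS omega1 \<alpha>. \<forall>V\<in>P \<beta>. U \<subseteq> V \<longrightarrow>
       fst (d U) \<subseteq> fst (h \<beta> V) \<and> (E V \<in> U \<longrightarrow> snd (d U) = snd (h \<beta> V))) \<and>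
    (\<forall>U\<in>S. \<forall>\<beta>\<in>underS omega1 \<alpha>. snd (d U) \<in> B \<beta> \<longrightarrow> fst (d U) \<subseteq> B \<beta>)"

abbreviation stage where "stage h \<alpha> d \<equiv> stage_on (P \<alpha>) h \<alpha> d"

lemma stage_onD:
  assumes "stage_on S h \<alpha> d" "U \<in> S"
  shows "openin Y (fst (d U))" "snd (d U) \<in> fst (d U)"
    "\<And>U'. U' \<in> S \<Longrightarrow> U \<noteq> U' \<Longrightarrow> fst (d U) \<inter> fst (d U') = {}"
    "\<And>\<beta> V. \<beta> \<in> underS omega1 \<alpha> \<Longrightarrow> V \<in> P \<beta> \<Longrightarrow> U \<subseteq> V \<Longrightarrow> fst (d U) \<subseteq> fst (h \<beta> V)"
    "\<And>\<beta> V. \<beta> \<in> underS omega1 \<alpha> \<Longrightarrow> V \<in> P \<beta> \<Longrightarrow> U \<subseteq> V \<Longrightarrow> E V \<in> U \<Longrightarrow> snd (d U) = snd (h \<beta> V)"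
    "\<And>\<beta>. \<beta> \<in> underS omega1 \<alpha> \<Longrightarrow> snd (d U) \<in> B \<beta> \<Longrightarrow> fst (d U) \<subseteq> B \<beta>"
  using assms unfolding stage_on_def by simp_all

text \<open>A stage looks only at earlier values of \<open>h\<close>, as well-founded choice
  requires.\<close>

lemma stage_cong:
  "(\<And>\<beta>. \<beta> \<in> underS omega1 \<alpha> \<Longrightarrow> h \<beta> = h' \<beta>) \<Longrightarrow> stage h \<alpha> d = stage h' \<alpha> d"
  unfolding stage_on_def by auto

text \<open>Thinness yields a label lying in the intersection of all cells above \<open>U\<close>; its image keeps the
  intersection of the corresponding open sets nonempty.\<close>

lemma common_point:
  assumes \<alpha>: "\<alpha> \<in> Field omega1" and h: "\<And>\<beta>. \<beta> \<in> underS omega1 \<alpha> \<Longrightarrow> stage h \<beta> (h \<beta>)"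
    and U: "U \<in> P \<alpha>"
  shows "\<exists>e q. e \<in> topspace X \<and> q \<in> topspace Y \<and>
    (\<forall>\<beta>\<in>underS omega1 \<alpha>. \<forall>V\<in>P \<beta>. U \<subseteq> V \<longrightarrow>
       q \<in> fst (h \<beta> V) \<and> (E V \<in> \<Inter>(above \<alpha> U) \<longrightarrow> E V = e \<and> snd (h \<beta> V) = q))"
proof (cases "above \<alpha> U = {}")
  case True
  \<comment> \<open>No earlier cell contains \<open>U\<close>, so the condition is vacuous and any
    two points serve.\<close>
  obtain e where "e \<in> U" using level_nonempty[OF \<alpha> U] by blast
  then have "e \<in> topspace X" using level_subset[OF \<alpha> U] by blast
  moreover obtain q where "q \<in> topspace Y" using nonempty_Y by blast
  moreover have "\<not> U \<subseteq> V" if "\<beta> \<in> underS omega1 \<alpha>" "V \<in> P \<beta>" for \<beta> V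
    using True that by (auto simp: above_def)
  ultimately show ?thesis using True by auto
next
  case False
  obtain x where x: "x \<in> U" using level_nonempty[OF \<alpha> U] by blast
  have "U \<subseteq> \<Inter>(above \<alpha> U)" by (auto simp: above_def)
  then have "\<Inter>(above \<alpha> U) \<noteq> {}" using x by blast
  moreover have "above \<alpha> U \<subseteq> (\<Union>\<beta>\<in>underS omega1 \<alpha>. P \<beta>)" by (auto simp: above_def)
  ultimately have "\<exists>V\<in>above \<alpha> U. E V \<in> \<Inter>(above \<alpha> U)"
    using thin[OF \<alpha> False] chain_above[OF \<alpha> U] by simp
  then obtain V0 where "V0 \<in> above \<alpha> U" and e: "E V0 \<in> \<Inter>(above \<alpha> U)" ..
  then obtain \<gamma> where \<gamma>: "\<gamma> \<in> underS omega1 \<alpha>" "V0 \<in> P \<gamma>" "U \<subseteq> V0" unfolding above_def by blast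
  note F = underS_omega1_Field
  define q where "q = snd (h \<gamma> V0)"
  have q: "q \<in> fst (h \<gamma> V0)" "openin Y (fst (h \<gamma> V0))"
    using stage_onD(1,2)[OF h[OF \<gamma>(1)] \<gamma>(2)] by (auto simp: q_def)
  show ?thesis
  proof (intro exI[of _ "E V0"] exI[of _ q] conjI ballI impI)
    show "E V0 \<in> topspace X" using label_in level_subset F \<gamma> by blast
    show "q \<in> topspace Y" using q openin_subset by blast
    fix \<beta> V assume V: "\<beta> \<in> underS omega1 \<alpha>" "V \<in> P \<beta>" "U \<subseteq> V"
    have xV: "x \<in> V" "x \<in> V0" using x V \<gamma> by auto
    have inV: "E V0 \<in> V" using e V by (auto simp: above_def)
    have "q \<in> fst (h \<beta> V) \<and> (E V \<in> \<Inter>(above \<alpha> U) \<longrightarrow> E V = E V0 \<and> snd (h \<beta> V) = q)"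
      using F[OF V(1)] F[OF \<gamma>(1)]
    proof (cases rule: omega1_cases)
      case 1
      then have "V = V0" using level_disjoint F V \<gamma> xV by blast
      then show ?thesis using 1 q q_def by simp
    next
      case 2
      \<comment> \<open>Here \<open>V0\<close> is finer: its open set lies in that of
        \<open>V\<close>, and a label of \<open>V\<close> in the common intersection lies in
        \<open>V0\<close> and is inherited by it.\<close>
      have sub: "V0 \<subseteq> V" using nested_cells[OF F[OF \<gamma>(1)] 2 \<gamma>(2) V(2) xV(2,1)] .
      have st: "fst (h \<gamma> V0) \<subseteq> fst (h \<beta> V) \<and> (E V \<in> V0 \<longrightarrow> snd (h \<gamma> V0) = snd (h \<beta> V))"
        using stage_onD(4,5)[OF h[OF \<gamma>(1)] \<gamma>(2) 2 V(2) sub] by blast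
      have "E V \<in> V0" if "E V \<in> \<Inter>(above \<alpha> U)" using that \<gamma> by (auto simp: above_def)
      then show ?thesis
        using label_inherit[OF F[OF \<gamma>(1)] F[OF V(1)] \<gamma>(2) V(2) sub] st q(1) q_def by auto
    next
      case 3
      \<comment> \<open>Here \<open>V\<close> is finer and contains \<open>E V0\<close>, so it
        inherits this label and the point \<open>q\<close>.\<close>
      have sub: "V \<subseteq> V0" using nested_cells[OF F[OF V(1)] 3 V(2) \<gamma>(2) xV] .
      have "snd (h \<beta> V) = q" "snd (h \<beta> V) \<in> fst (h \<beta> V)"
        using stage_onD(5)[OF h[OF V(1)] V(2) 3 \<gamma>(2) sub inV] stage_onD(2)[OF h[OF V(1)] V(2)] by (simp_all add: q_def)
      then show ?thesis
        using label_inherit[OF F[OF V(1)] F[OF \<gamma>(1)] V(2) \<gamma>(2) sub inV] by auto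
    qed
    then show "q \<in> fst (h \<beta> V)"
      and "E V \<in> \<Inter>(above \<alpha> U) \<Longrightarrow> E V = E V0" "E V \<in> \<Inter>(above \<alpha> U) \<Longrightarrow> snd (h \<beta> V) = q" by simp_all
  qed
qed

text \<open>All cells with the history of \<open>U0\<close> must fit into the same countable
  intersection \<open>M\<close>. It contains the point from \<open>common_point\<close> and is open,
  so a disjoint system inside \<open>M\<close> serves the whole class.\<close>

lemma stage_class:
  assumes \<alpha>: "\<alpha> \<in> Field omega1" and h: "\<And>\<beta>. \<beta> \<in> underS omega1 \<alpha> \<Longrightarrow> stage h \<beta> (h \<beta>)"
    and U0: "U0 \<in> P \<alpha>"
  shows "\<exists>d. stage_on {U \<in> P \<alpha>. above \<alpha> U = above \<alpha> U0} h \<alpha> d"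
proof -
  note F = underS_omega1_Field
  have cnt: "countable (underS omega1 \<alpha>)" by (rule countable_underS_omega1[OF \<alpha>])
  obtain e q where eq: "e \<in> topspace X" "q \<in> topspace Y"
    and q: "\<forall>\<beta>\<in>underS omega1 \<alpha>. \<forall>V\<in>P \<beta>. U0 \<subseteq> V \<longrightarrow>
       q \<in> fst (h \<beta> V) \<and> (E V \<in> \<Inter>(above \<alpha> U0) \<longrightarrow> E V = e \<and> snd (h \<beta> V) = q)"
    using common_point[of \<alpha> h U0] \<alpha> h U0 by blast
  obtain Ue where Ue: "Ue \<in> P \<alpha>" "e \<in> Ue" using level_cover[OF \<alpha> eq(1)] by blast
  obtain a where a: "\<And>\<beta>. \<beta> \<in> underS omega1 \<alpha> \<Longrightarrow> a \<beta> \<in> P \<beta> \<and> U0 \<subseteq> a \<beta>"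
    using refines_level[OF \<alpha> _ U0] by metis
  \<comment> \<open>The factor \<open>topspace Y\<close> matters at the first level, where there are
    no earlier sets.\<close>
  define M where "M = topspace Y \<inter> (\<Inter>\<beta>\<in>underS omega1 \<alpha>. fst (h \<beta> (a \<beta>)))"
  have M: "openin Y M" unfolding M_def
  proof (rule P_space_openin_INT[OF P_space_Y _ cnt])
    show "openin Y (fst (h \<beta> (a \<beta>)))" if "\<beta> \<in> underS omega1 \<alpha>" for \<beta>
      using stage_onD(1)[OF h[OF that]] a[OF that] by blast
  qed simp
  have qM: "q \<in> M" unfolding M_def using eq(2) q a by blast
  obtain w where w: "\<And>U. U \<in> P \<alpha> \<Longrightarrow> openin Y (w U) \<and> w U \<noteq> {} \<and> w U \<subseteq> M"
    and disj: "disjoint_family_on w (P \<alpha>)" and qw: "q \<in> w Ue"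
    using disjoint_open_system[OF P_space_Y crowded_Y M qM card_le[OF \<alpha>]] by metis
  \<comment> \<open>An earlier label found in a cell of this class can only be \<open>e\<close>. So
    \<open>Ue\<close> alone may have a prescribed point, and that point is \<open>q\<close>.\<close>
  define p where "p U = (if U = Ue then q else SOME y. y \<in> w U)" for U
  have p: "p U \<in> w U" if "U \<in> P \<alpha>" for U
    unfolding p_def using qw w[OF that] by (auto intro: someI_ex)
  \<comment> \<open>Shrinking into the earlier basic sets around \<open>p U\<close>, countably many,
    secures the last clause of \<open>stage_on\<close>.\<close>
  define W where "W U = w U \<inter> (\<Inter>\<beta>\<in>{\<beta>\<in>underS omega1 \<alpha>. p U \<in> B \<beta>}. B \<beta>)" for U
  have W: "openin Y (W U)" if "U \<in> P \<alpha>" for U unfolding W_def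
    by (rule P_space_openin_INT[OF P_space_Y]) (use w[OF that] cnt openin_B F in auto)
  have pW: "p U \<in> W U" if "U \<in> P \<alpha>" for U using p[OF that] by (auto simp: W_def)
  have disjW: "W U \<inter> W U' = {}" if "U \<in> P \<alpha>" "U' \<in> P \<alpha>" "U \<noteq> U'" for U U'
    using disjoint_family_onD[OF disj that] by (auto simp: W_def)
  have sub: "U0 \<subseteq> V \<and> W U \<subseteq> fst (h \<beta> V) \<and> (E V \<in> U \<longrightarrow> p U = snd (h \<beta> V))"
    if U: "U \<in> P \<alpha>" "above \<alpha> U = above \<alpha> U0" and V: "\<beta> \<in> underS omega1 \<alpha>" "V \<in> P \<beta>" "U \<subseteq> V" for U \<beta> V
  proof -
    have "V \<in> above \<alpha> U0" using U V by (auto simp: above_def)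
    then have U0V: "U0 \<subseteq> V" by (auto simp: above_def)
    \<comment> \<open>All cells of the class lie in the same cell of level \<open>\<beta>\<close>,
      whose open set was used to form \<open>M\<close>.\<close>
    have "V = a \<beta>"
      using level_disjoint[OF F[OF V(1)] V(2)] a[OF V(1)] U0V level_nonempty[OF \<alpha> U0] by blast
    then have "W U \<subseteq> fst (h \<beta> V)" using w[OF U(1)] V(1) by (auto simp: W_def M_def)
    moreover have "p U = snd (h \<beta> V)" if EV: "E V \<in> U"
    proof -
      have "E V \<in> \<Inter>(above \<alpha> U)" using EV by (auto simp: above_def)
      then have *: "E V = e" "snd (h \<beta> V) = q" using bspec[OF bspec[OF q V(1)] V(2)] U0V U(2) by auto
      then have "U = Ue" using level_disjoint[OF \<alpha> U(1) Ue(1)] EV Ue(2) by blast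
      then show ?thesis using * by (simp add: p_def)
    qed
    ultimately show ?thesis using U0V by blast
  qed
  show ?thesis
  proof (rule exI[of _ "\<lambda>U. (W U, p U)"])
    show "stage_on {U \<in> P \<alpha>. above \<alpha> U = above \<alpha> U0} h \<alpha> (\<lambda>U. (W U, p U))"
      unfolding stage_on_def fst_conv snd_conv
    proof (intro conjI ballI impI)
      fix U \<beta> assume "U \<in> {U \<in> P \<alpha>. above \<alpha> U = above \<alpha> U0}" "\<beta> \<in> underS omega1 \<alpha>" "p U \<in> B \<beta>"
      then show "W U \<subseteq> B \<beta>" by (auto simp: W_def)
    qed (use W pW disjW sub in simp_all)
  qed
qed

text \<open>The classes are handled separately and glued. Different histories diverge at some
  earlier level, where the assigned sets are already disjoint.\<close>

lemma stage_exists: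
  assumes \<alpha>: "\<alpha> \<in> Field omega1" and h: "\<And>\<beta>. \<beta> \<in> underS omega1 \<alpha> \<Longrightarrow> stage h \<beta> (h \<beta>)"
  shows "\<exists>d. stage h \<alpha> d"
proof -
  \<comment> \<open>The choice is indexed by histories, not cells, so that all cells of a class use
    the same partial stage.\<close>
  have "\<forall>\<L>\<in>above \<alpha> ` P \<alpha>. \<exists>d. stage_on {U \<in> P \<alpha>. above \<alpha> U = \<L>} h \<alpha> d"
    using stage_class[of \<alpha> h] \<alpha> h by blast
  from bchoice[OF this] obtain D where
    D: "\<And>U. U \<in> P \<alpha> \<Longrightarrow> stage_on {U' \<in> P \<alpha>. above \<alpha> U' = above \<alpha> U} h \<alpha> (D (above \<alpha> U))"
    by auto
  define d where "d U = D (above \<alpha> U) U" for U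
  have d: "openin Y (fst (d U))" "snd (d U) \<in> fst (d U)"
    "\<And>U'. U' \<in> P \<alpha> \<Longrightarrow> above \<alpha> U' = above \<alpha> U \<Longrightarrow> U \<noteq> U' \<Longrightarrow> fst (d U) \<inter> fst (d U') = {}"
    "\<And>\<beta> V. \<beta> \<in> underS omega1 \<alpha> \<Longrightarrow> V \<in> P \<beta> \<Longrightarrow> U \<subseteq> V \<Longrightarrow> fst (d U) \<subseteq> fst (h \<beta> V)"
    "\<And>\<beta> V. \<beta> \<in> underS omega1 \<alpha> \<Longrightarrow> V \<in> P \<beta> \<Longrightarrow> U \<subseteq> V \<Longrightarrow> E V \<in> U \<Longrightarrow> snd (d U) = snd (h \<beta> V)"
    "\<And>\<beta>. \<beta> \<in> underS omega1 \<alpha> \<Longrightarrow> snd (d U) \<in> B \<beta> \<Longrightarrow> fst (d U) \<subseteq> B \<beta>"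
    if U: "U \<in> P \<alpha>" for U
    using stage_onD[OF D[OF U], of U] U by (simp_all add: d_def)
  have disj_sub: "fst (d U) \<inter> fst (d U') = {}"
    if U: "U \<in> P \<alpha>" "U' \<in> P \<alpha>" and V: "V \<in> above \<alpha> U" "V \<notin> above \<alpha> U'" for U U' V
  proof -
    obtain \<beta> where \<beta>: "\<beta> \<in> underS omega1 \<alpha>" "V \<in> P \<beta>" "U \<subseteq> V" using V unfolding above_def by blast
    \<comment> \<open>\<open>V\<close> and \<open>V'\<close> are distinct cells of one level; the
      disjointness of their open sets passes down to \<open>U\<close> and \<open>U'\<close>.\<close>
    obtain V' where V': "V' \<in> P \<beta>" "U' \<subseteq> V'" using refines_level[OF \<alpha> \<beta>(1) U(2)] by blast
    then have "V' \<noteq> V" using V \<beta> by (auto simp: above_def)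
    then have "fst (h \<beta> V) \<inter> fst (h \<beta> V') = {}"
      using stage_onD(3)[OF h[OF \<beta>(1)] \<beta>(2) V'(1)] by blast
    then show ?thesis using d(4)[OF U(1) \<beta>] d(4)[OF U(2) \<beta>(1) V'] by blast
  qed
  have disj: "fst (d U) \<inter> fst (d U') = {}" if U: "U \<in> P \<alpha>" "U' \<in> P \<alpha>" "U \<noteq> U'" for U U'
  proof (cases "above \<alpha> U' = above \<alpha> U")
    case True
    then show ?thesis using d(3) U by blast
  next
    case False
    then show ?thesis using disj_sub[OF U(1,2)] disj_sub[OF U(2,1)] by blast
  qed
  have "stage h \<alpha> d"
    unfolding stage_on_def by (intro conjI ballI impI d disj)
  then show ?thesis by blast
qed

lemma stages: obtains h where "\<And>\<alpha>. \<alpha> \<in> Field omega1 \<Longrightarrow> stage h \<alpha> (h \<alpha>)"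
proof -
  \<comment> \<open>Choice runs over the whole type, so the stage condition is guarded by membership
    in the field.\<close>
  have "\<exists>h. \<forall>\<alpha>. \<alpha> \<in> Field omega1 \<longrightarrow> stage h \<alpha> (h \<alpha>)"
  proof (rule dependent_wf_choice[OF wf_omega1])
    show "(\<alpha> \<in> Field omega1 \<longrightarrow> stage f \<alpha> r) = (\<alpha> \<in> Field omega1 \<longrightarrow> stage g \<alpha> r)"
      if "\<And>\<beta>. (\<beta>, \<alpha>) \<in> {(\<beta>, \<alpha>). \<beta> \<in> underS omega1 \<alpha>} \<Longrightarrow> f \<beta> = g \<beta>" for f g \<alpha> r
      using stage_cong[of \<alpha> f g] that by auto
    show "\<exists>r. \<alpha> \<in> Field omega1 \<longrightarrow> stage f \<alpha> r"
      if "\<And>\<beta>. (\<beta>, \<alpha>) \<in> {(\<beta>, \<alpha>). \<beta> \<in> underS omega1 \<alpha>} \<Longrightarrow> \<beta> \<in> Field omega1 \<longrightarrow> stage f \<beta> (f \<beta>)" for f \<alpha>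
      using stage_exists[of \<alpha> f] that underS_omega1_Field by blast
  qed
  then show thesis using that by blast
qed

section \<open>The embedding\<close>

text \<open>Every point of \<open>X\<close> is a label and is sent to the point assigned to its
  cells. Disjointness within levels gives \<open>f_iff\<close>, hence injectivity and openness; the
  shrinking into the sets \<open>B \<beta>\<close> gives continuity.\<close>

lemma dim_type_le_target: "dim_type_le X Y"
proof -
  note F = underS_omega1_Field
  obtain h where h: "\<And>\<alpha>. \<alpha> \<in> Field omega1 \<Longrightarrow> stage h \<alpha> (h \<alpha>)" using stages by blast
  note s = stage_onD[OF h]
  \<comment> \<open>A point may label many cells; \<open>z\<close> fixes a level and a cell for
    each, and \<open>f_eq\<close> shows that the choice is immaterial.\<close>
  have "\<forall>x\<in>topspace X. \<exists>z. fst z \<in> Field omega1 \<and> snd z \<in> P (fst z) \<and> E (snd z) = x"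
    using label_surj by (metis fst_conv snd_conv)
  from bchoice[OF this] obtain z where
    z: "\<And>x. x \<in> topspace X \<Longrightarrow> fst (z x) \<in> Field omega1 \<and> snd (z x) \<in> P (fst (z x)) \<and> E (snd (z x)) = x"
    by blast
  define f where "f x = snd (h (fst (z x)) (snd (z x)))" for x
  have f_eq: "f x = snd (h \<alpha> V)" if x: "x \<in> topspace X" and V: "\<alpha> \<in> Field omega1" "V \<in> P \<alpha>" "E V = x" for x \<alpha> V
  proof -
    obtain \<gamma> W where W: "\<gamma> \<in> Field omega1" "W \<in> P \<gamma>" "E W = x" "f x = snd (h \<gamma> W)"
      using z[OF x] f_def by blast
    \<comment> \<open>Sharing \<open>x\<close>, the two cells are nested, and the finer one
      inherited the point of the coarser.\<close>
    have xs: "x \<in> V" "x \<in> W" using label_in[OF V(1,2)] label_in[OF W(1,2)] V(3) W(3) by simp_all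
    show ?thesis using V(1) W(1)
    proof (cases rule: omega1_cases)
      case 1
      then show ?thesis using level_disjoint[OF V(1,2) _ xs] W by simp
    next
      case 2
      have "W \<subseteq> V" using nested_cells[OF W(1) 2 W(2) V(2) xs(2,1)] .
      then have "snd (h \<gamma> W) = snd (h \<alpha> V)" using s(5)[OF W(1,2) 2 V(2)] V(3) xs by simp
      then show ?thesis using W(4) by simp
    next
      case 3
      have "V \<subseteq> W" using nested_cells[OF V(1) 3 V(2) W(2) xs] .
      then have "snd (h \<alpha> V) = snd (h \<gamma> W)" using s(5)[OF V(1,2) 3 W(2)] W(3) xs by simp
      then show ?thesis using W(4) by simp
    qed
  qed
  have f_in: "f x \<in> fst (h \<alpha> V)" if V: "\<alpha> \<in> Field omega1" "V \<in> P \<alpha>" "x \<in> V" for x \<alpha> V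
  proof -
    have x: "x \<in> topspace X" using level_subset V by blast
    obtain \<gamma> W where W: "\<gamma> \<in> Field omega1" "W \<in> P \<gamma>" "E W = x" using label_surj[OF x] by blast
    have fW: "f x = snd (h \<gamma> W)" using f_eq[OF x W] .
    have xW: "x \<in> W" using label_in[OF W(1,2)] W(3) by simp
    \<comment> \<open>If \<open>W\<close> is finer, its open set lies in that of \<open>V\<close>;
      if \<open>V\<close> is finer, it contains the label of \<open>W\<close> and carries the same
      point.\<close>
    show ?thesis using V(1) W(1)
    proof (cases rule: omega1_cases)
      case 1
      then show ?thesis using level_disjoint[OF V(1,2) _ V(3) xW] W s(2)[OF V(1,2)] fW by simp
    next
      case 2
      have "W \<subseteq> V" using nested_cells[OF W(1) 2 W(2) V(2) xW V(3)] .
      then show ?thesis using s(4)[OF W(1,2) 2 V(2)] s(2)[OF W(1,2)] fW by auto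
    next
      case 3
      have "V \<subseteq> W" using nested_cells[OF V(1) 3 V(2) W(2) V(3) xW] .
      then have "snd (h \<alpha> V) = snd (h \<gamma> W)" using s(5)[OF V(1,2) 3 W(2)] W(3) V(3) by simp
      then show ?thesis using fW s(2)[OF V(1,2)] by simp
    qed
  qed
  have f_iff: "f x \<in> fst (h \<alpha> V) \<longleftrightarrow> x \<in> V"
    if V: "\<alpha> \<in> Field omega1" "V \<in> P \<alpha>" and x: "x \<in> topspace X" for x \<alpha> V
  proof
    assume *: "f x \<in> fst (h \<alpha> V)"
    obtain W where W: "W \<in> P \<alpha>" "x \<in> W" using level_cover[OF V(1) x] by blast
    then show "x \<in> V" using f_in[OF V(1) W] s(3)[OF V(1) W(1) V(2)] * by blast
  qed (use f_in V in blast)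
  have small_cell: "\<exists>\<alpha>\<in>Field omega1. \<exists>V\<in>P \<alpha>. x \<in> V \<and> V \<subseteq> G" if G: "openin X G" "x \<in> G" for x G
  proof -
    have "is_base X (cells P)" by (rule P_matrix_base[OF matrix])
    then obtain V where "V \<in> cells P" "x \<in> V" "V \<subseteq> G" using G unfolding is_base_def by meson
    then show ?thesis unfolding cells_def by blast
  qed
  have fY: "f x \<in> topspace Y" if x: "x \<in> topspace X" for x
  proof -
    obtain G where "openin X G" "x \<in> G" using x by blast
    then obtain \<alpha> V where V: "\<alpha> \<in> Field omega1" "V \<in> P \<alpha>" "x \<in> V" using small_cell by blast
    show ?thesis using f_in[OF V] openin_subset[OF s(1)[OF V(1,2)]] by blast
  qed
  define S where "S = f ` topspace X"
  have SY: "S \<subseteq> topspace Y" using fY by (auto simp: S_def)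
  then have topS: "topspace (subtopology Y S) = S" by auto
  have open_cell: "openin X V" if "\<alpha> \<in> Field omega1" "V \<in> P \<alpha>" for \<alpha> V
    using open_partition_level[OF that(1)] that(2) by (auto simp: open_partition_def)
  have "homeomorphic_map X (subtopology Y S) f"
  proof (rule bijective_open_imp_homeomorphic_map)
    show "f ` topspace X = topspace (subtopology Y S)" using topS S_def by simp
    show "open_map X (subtopology Y S) f" unfolding open_map_def
    proof (intro allI impI)
      fix G assume G: "openin X G"
      show "openin (subtopology Y S) (f ` G)"
      proof (subst openin_subopen, intro ballI)
        fix y assume "y \<in> f ` G"
        then obtain x where x: "x \<in> G" "y = f x" by blast
        obtain \<alpha> V where V: "\<alpha> \<in> Field omega1" "V \<in> P \<alpha>" "x \<in> V" "V \<subseteq> G" using small_cell[OF G x(1)] by blast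
        have "openin (subtopology Y S) (fst (h \<alpha> V) \<inter> S)"
          using s(1)[OF V(1,2)] by (auto simp: openin_subtopology)
        moreover have "y \<in> fst (h \<alpha> V) \<inter> S"
          using f_in[OF V(1-3)] x openin_subset[OF G] by (auto simp: S_def)
        \<comment> \<open>By \<open>f_iff\<close>, the only image points in the open set of
          \<open>V\<close> come from \<open>V\<close>.\<close>
        moreover have "fst (h \<alpha> V) \<inter> S \<subseteq> f ` G" using f_iff[OF V(1,2)] V(4) by (auto simp: S_def)
        ultimately show "\<exists>T. openin (subtopology Y S) T \<and> y \<in> T \<and> T \<subseteq> f ` G" by blast
      qed
    qed
    show "inj_on f (topspace X)"
    proof (rule inj_onI, rule ccontr)
      fix x x' assume x: "x \<in> topspace X" "x' \<in> topspace X" "f x = f x'" "x \<noteq> x'"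
      have "\<exists>G. openin X G \<and> x \<in> G \<and> x' \<notin> G"
        using T1 x unfolding t1_space_def by metis
      then obtain G where G: "openin X G" "x \<in> G" "x' \<notin> G" by blast
      obtain \<alpha> V where V: "\<alpha> \<in> Field omega1" "V \<in> P \<alpha>" "x \<in> V" "V \<subseteq> G" using small_cell[OF G(1,2)] by blast
      then show False using f_iff[OF V(1,2) x(1)] f_iff[OF V(1,2) x(2)] x(3) G(3) by auto
    qed
    have "\<exists>T. openin X T \<and> x \<in> T \<and> T \<subseteq> {x \<in> topspace X. f x \<in> G}"
      if G: "openin Y G" and x: "x \<in> topspace X" "f x \<in> G" for G x
    proof -
      have "\<exists>A\<in>B ` Field omega1. f x \<in> A \<and> A \<subseteq> G"
        using base_Y G x(2) unfolding is_base_def by meson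
      then obtain \<beta> where \<beta>: "\<beta> \<in> Field omega1" "f x \<in> B \<beta>" "B \<beta> \<subseteq> G" by auto
      obtain \<gamma> W where W: "\<gamma> \<in> Field omega1" "W \<in> P \<gamma>" "E W = x" using label_surj[OF x(1)] by blast
      have xW: "x \<in> W" using label_in[OF W(1,2)] W(3) by simp
      \<comment> \<open>Beyond \<open>\<gamma>\<close> the cell around \<open>x\<close> still has
        label \<open>x\<close>; beyond \<open>\<beta>\<close> its open set is shrunk into
        \<open>B \<beta>\<close>.\<close>
      obtain \<alpha> where \<alpha>: "\<alpha> \<in> Field omega1" "\<beta> \<in> underS omega1 \<alpha>" "\<gamma> \<in> underS omega1 \<alpha>"
        using omega1_upper_bound[OF \<beta>(1) W(1)] by blast
      obtain V where V: "V \<in> P \<alpha>" "x \<in> V" using level_cover[OF \<alpha>(1) x(1)] by blast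
      have "V \<subseteq> W" using nested_cells[OF \<alpha>(1,3) V(1) W(2) V(2) xW] .
      then have "E V = x" using label_inherit[OF \<alpha>(1) W(1) V(1) W(2)] W(3) V(2) by simp
      then have "snd (h \<alpha> V) \<in> B \<beta>" using f_eq[OF x(1) \<alpha>(1) V(1)] \<beta>(2) by simp
      then have "fst (h \<alpha> V) \<subseteq> G" using s(6)[OF \<alpha>(1) V(1) \<alpha>(2)] \<beta>(3) by blast
      then have "V \<subseteq> {x \<in> topspace X. f x \<in> G}"
        using f_in[OF \<alpha>(1) V(1)] level_subset[OF \<alpha>(1) V(1)] by blast
      then show ?thesis
        using open_cell[OF \<alpha>(1) V(1)] V(2) by blast
    qed
    then have "openin X {x \<in> topspace X. f x \<in> G}" if "openin Y G" for G
      using that by (subst openin_subopen) simp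
    then have "continuous_map X Y f" using fY by (simp add: continuous_map_def)
    then show "continuous_map X (subtopology Y S) f"
      by (auto simp: continuous_map_in_subtopology S_def)
  qed
  then show ?thesis unfolding dim_type_le_def using SY homeomorphic_map_imp_homeomorphic_space by blast
qed

end

section \<open>Bases and weight\<close>

text \<open>By T1 the basic sets around \<open>x\<close> intersect in \<open>{x}\<close>. Were they
  countably many, \<open>{x}\<close> would be open, against crowdedness.\<close>

lemma uncountable_base:
  assumes X: "P_space X" "crowded X" "topspace X \<noteq> {}" and B: "is_base X \<B>"
  shows "uncountable \<B>"
proof
  assume cB: "countable \<B>"
  obtain x where x: "x \<in> topspace X" using X(3) by blast
  let ?N = "topspace X \<inter> (\<Inter>G\<in>{G\<in>\<B>. x \<in> G}. G)"
  have "openin X ?N"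
    by (rule P_space_openin_INT[OF X(1)]) (use cB B in \<open>auto simp: is_base_def\<close>)
  moreover have "?N = {x}"
  proof -
    have "y = x" if y: "y \<in> ?N" for y
    proof (rule ccontr)
      assume "y \<noteq> x"
      then have "\<exists>G. openin X G \<and> x \<in> G \<and> y \<notin> G"
        using X(1) x y unfolding P_space_def t1_space_def by (metis IntD1)
      then show False using B y unfolding is_base_def by blast
    qed
    then show ?thesis using x by blast
  qed
  ultimately show False using X(2) x by (simp add: crowded_def)
qed

text \<open>A base of size \<open>omega1\<close> is enumerated by the field. The space is nonempty
  because an empty one has the empty base, which is too small.\<close>

lemma has_weight_omega1D:
  assumes "has_weight Y omega1"
  obtains B where "is_base Y (B ` Field omega1)" "topspace Y \<noteq> {}"
proof -
  obtain \<B> where B: "is_base Y \<B>" "|\<B>| =o omega1" using assms by (auto simp: has_weight_def)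
  have "|Field omega1| =o |\<B>|"
    using B(2) card_of_Field_ordIso[OF Card_order_omega1] ordIso_transitive ordIso_symmetric by blast
  then obtain B where "bij_betw B (Field omega1) \<B>" by (auto simp: card_of_ordIso[symmetric])
  moreover have "topspace Y \<noteq> {}"
  proof
    assume "topspace Y = {}"
    then have "is_base Y {}" using openin_subset by (fastforce simp: is_base_def)
    then have "omega1 \<le>o |{} :: 'a set set|" using assms by (auto simp: has_weight_def)
    then show False by (simp add: omega1_ordLeq_iff_uncountable)
  qed
  ultimately show thesis using that B(1) by (auto simp: bij_betw_def)
qed

section \<open>Thin labelings of size at most \<open>omega1\<close>\<close>

lemma has_thin_labelingE:
  fixes \<kappa> :: "'k rel"
  assumes "has_thin_labeling \<kappa> X"
  obtains P E where "P_matrix X P" "labeling X P E" "Cinfinite \<kappa>"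
    "\<forall>\<alpha>\<in>Field omega1. |P \<alpha>| =o \<kappa>"
    "\<forall>\<alpha>\<in>Field omega1. \<forall>\<beta>\<in>underS omega1 \<alpha>. \<forall>V\<in>P \<beta>. |{U \<in> P \<alpha>. U \<subseteq> V}| =o \<kappa>"
    "\<forall>\<alpha>\<in>Field omega1. \<forall>\<L>.
      \<L> \<noteq> {} \<and> \<L> \<subseteq> (\<Union>\<beta>\<in>underS omega1 \<alpha>. P \<beta>) \<and> chain\<^sub>\<subseteq> \<L> \<and> \<Inter>\<L> \<noteq> {} \<longrightarrow>
      (\<exists>V\<in>\<L>. E V \<in> \<Inter>\<L>)"
  using assms unfolding has_thin_labeling_def
  by (elim conjE exE) (rule that; (assumption | (rule conjI; assumption)))

text \<open>The cells form a base made of \<open>omega1\<close> levels of size at most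
  \<open>omega1\<close>, which bounds the weight from above; \<open>uncountable_base\<close> bounds
  it from below.\<close>

lemma thin_labeling_imp_class:
  fixes X :: "'a topology" and \<kappa> :: "'k rel"
  assumes X: "P_space X" and thin: "has_thin_labeling \<kappa> X" and le: "\<kappa> \<le>o omega1"
  shows "crowded_P_space_of_weight_omega1 X"
proof -
  obtain P E where PE: "P_matrix X P" "Cinfinite \<kappa>"
    and card: "\<forall>\<alpha>\<in>Field omega1. |P \<alpha>| =o \<kappa>"
    and sub: "\<forall>\<alpha>\<in>Field omega1. \<forall>\<beta>\<in>underS omega1 \<alpha>. \<forall>V\<in>P \<beta>. |{U \<in> P \<alpha>. U \<subseteq> V}| =o \<kappa>"
    using thin by (rule has_thin_labelingE)
  have base: "is_base X (cells P)" by (rule P_matrix_base[OF PE(1)])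
  have part: "partition_on (topspace X) (P \<alpha>)" if "\<alpha> \<in> Field omega1" for \<alpha>
    using P_matrix_open_partition[OF PE(1) that] by (simp add: open_partition_def)
  have inf: "infinite A" if "|A| =o \<kappa>" for A :: "'a set set"
    using PE(2) that by (meson cinfinite_def card_of_ordIso_finite_Field ordIso_symmetric)
  have crowded: "crowded X" unfolding crowded_def
  proof (intro ballI notI)
    fix x assume "openin X {x}"
    then obtain V where V: "V \<in> cells P" "x \<in> V" "V \<subseteq> {x}" using base unfolding is_base_def by blast
    then have "V = {x}" by blast
    with V(1) obtain \<beta> where \<beta>: "\<beta> \<in> Field omega1" "{x} \<in> P \<beta>" unfolding cells_def by blast
    obtain \<alpha> where \<alpha>: "\<alpha> \<in> Field omega1" "\<beta> \<in> underS omega1 \<alpha>" using omega1_no_max[OF \<beta>(1)] by blast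
    \<comment> \<open>An isolated point is a cell by itself. It has finitely many subsets, yet
      infinitely many later cells must lie in it.\<close>
    have "{U \<in> P \<alpha>. U \<subseteq> {x}} \<subseteq> Pow {x}" by blast
    then have "finite {U \<in> P \<alpha>. U \<subseteq> {x}}" by (rule finite_subset) simp
    then show False using inf[OF bspec[OF bspec[OF bspec[OF sub \<alpha>(1)] \<alpha>(2)] \<beta>(2)]] by blast
  qed
  obtain \<alpha> where \<alpha>: "\<alpha> \<in> Field omega1" using infinite_omega1 by fastforce
  have "infinite (P \<alpha>)" using inf card \<alpha> by blast
  then have nonempty: "topspace X \<noteq> {}"
    using partition_on_empty part[OF \<alpha>] by (metis finite.emptyI)
  have lower: "omega1 \<le>o |\<B>|" if "is_base X \<B>" for \<B>
    using uncountable_base[OF X crowded nonempty that] by (simp only: omega1_ordLeq_iff_uncountable simp_thms)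
  have iso: "|Field omega1| =o omega1" by (rule card_of_Field_ordIso[OF Card_order_omega1])
  have "|P \<alpha>| \<le>o |Field omega1|" if "\<alpha> \<in> Field omega1" for \<alpha>
    using bspec[OF card that] le iso by (meson ordIso_ordLeq_trans ordLeq_ordIso_trans ordIso_symmetric)
  then have "|cells P| \<le>o |Field omega1|" unfolding cells_def
    by (intro card_of_UNION_ordLeq_infinite infinite_omega1 card_of_mono1 subset_refl ballI)
  then have "|cells P| \<le>o omega1" using iso by (rule ordLeq_ordIso_trans)
  then have "|cells P| =o omega1" using lower[OF base] by (simp add: ordIso_iff_ordLeq)
  then have "has_weight X omega1" unfolding has_weight_def
    by (intro conjI exI[of _ "cells P"] allI impI lower base)
  then show ?thesis using X crowded by (simp add: crowded_P_space_of_weight_omega1_def)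
qed

text \<open>The thin labeling of \<open>X\<close> and an enumerated base of \<open>Y\<close>
  instantiate the construction, with \<open>\<kappa> \<le>o omega1\<close> bounding the
  levels.\<close>

lemma thin_labeling_imp_dim_type_le:
  fixes \<kappa> :: "'k rel"
  assumes X: "P_space X" and thin: "has_thin_labeling \<kappa> X" and le: "\<kappa> \<le>o omega1"
    and Y: "crowded_P_space_of_weight_omega1 Y"
  shows "dim_type_le X Y"
proof -
  obtain P E where PE: "P_matrix X P" "labeling X P E"
    and card: "\<forall>\<alpha>\<in>Field omega1. |P \<alpha>| =o \<kappa>"
    and chains: "\<forall>\<alpha>\<in>Field omega1. \<forall>\<L>.
      \<L> \<noteq> {} \<and> \<L> \<subseteq> (\<Union>\<beta>\<in>underS omega1 \<alpha>. P \<beta>) \<and> chain\<^sub>\<subseteq> \<L> \<and> \<Inter>\<L> \<noteq> {} \<longrightarrow>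
      (\<exists>V\<in>\<L>. E V \<in> \<Inter>\<L>)"
    using thin by (rule has_thin_labelingE)
  obtain B where B: "is_base Y (B ` Field omega1)" "topspace Y \<noteq> {}"
    using Y has_weight_omega1D unfolding crowded_P_space_of_weight_omega1_def by metis
  interpret thin_matrix_target X P E Y B
  proof
    show "t1_space X" using X by (simp add: P_space_def)
    show "|P \<alpha>| \<le>o omega1" if "\<alpha> \<in> Field omega1" for \<alpha>
      using bspec[OF card that] le by (rule ordIso_ordLeq_trans)
    show "\<exists>V\<in>\<L>. E V \<in> \<Inter>\<L>"
      if "\<alpha> \<in> Field omega1" "\<L> \<noteq> {}" "\<L> \<subseteq> (\<Union>\<beta>\<in>underS omega1 \<alpha>. P \<beta>)" "chain\<^sub>\<subseteq> \<L>" "\<Inter>\<L> \<noteq> {}" for \<alpha> \<L>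
      using bspec[OF chains that(1)] that(2-) by simp
    show "P_space Y" "crowded Y" using Y by (simp_all add: crowded_P_space_of_weight_omega1_def)
  qed (fact PE B)+
  show ?thesis by (rule dim_type_le_target)
qed

theorem corollary30:
  fixes X :: "'a topology"
  assumes "P_space X"
    and "has_thin_labeling natLeq X \<or> has_thin_labeling omega1 X"
  shows "crowded_P_space_of_weight_omega1 X \<and>
    (\<forall>Y :: 'b topology. crowded_P_space_of_weight_omega1 Y \<longrightarrow> dim_type_le X Y)"
  using assms(2)
proof
  assume thin: "has_thin_labeling natLeq X"
  have "natLeq \<le>o omega1" by (rule cardSuc_ordLeq[OF natLeq_Card_order])
  note facts = assms(1) thin this
  show ?thesis
    by (intro conjI allI impI thin_labeling_imp_class[OF facts] thin_labeling_imp_dim_type_le[OF facts])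
next
  assume thin: "has_thin_labeling omega1 X"
  have "omega1 \<le>o omega1" using Card_order_omega1 by (simp add: ordLeq_reflexive card_order_on_def)
  note facts = assms(1) thin this
  show ?thesis
    by (intro conjI allI impI thin_labeling_imp_class[OF facts] thin_labeling_imp_dim_type_le[OF facts])
qed

end
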